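(* Let $\lambda>0$. A smooth vector field on $(H_3,g_0)$ is affine if and only if it is Killing.
   Context: The Heisenberg group $H_3$ is $\mathbb{R}^3$ with global coordinates $(x,y,z)$ and multiplication $(x,y,z)(\tilde x,\tilde y,\tilde z)=(x+\tilde x,y+\tilde y,z+\tilde z-x\tilde y)$. For $\lambda>0$, $g_0$ is the left-invariant Riemannian metric $g_0=\frac{1}{\lambda^2}dx^2+dy^2+(x\,dy+dz)^2$. A smooth vector field $X$ on a pseudo-Riemannian manifold $(M,g)$ with Levi-Civita connection $\nabla$ is Killing if $\mathcal{L}_Xg=0$, and affine if $\mathcal{L}_X\nabla=0$, i.e. $[X,\nabla_YZ]=\nabla_{[X,Y]}Z+\nabla_Y[X,Z]$ for all vector fields $Y,Z$. *)

theory Defs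
  imports "HOL-Analysis.Analysis"
begin

section \<open>Smooth maps and vector fields on a Euclidean space\<close>

text \<open>A vector field on the manifold \<open>'a\<close> (with its global chart) is a map
  \<open>'a \<Rightarrow> 'a\<close>; a metric assigns to every point a form on the tangent space
  \<open>'a\<close>.\<close>

type_synonym 'a vfield = "'a \<Rightarrow> 'a"
type_synonym 'a metric = "'a \<Rightarrow> 'a \<Rightarrow> 'a \<Rightarrow> real"

text \<open>In finite dimension it is enough to iterate the derivative along fixed
  directions \<open>v\<close>, which keeps the type of \<open>f\<close>.\<close>

primrec Ck :: "nat \<Rightarrow> ('a::euclidean_space \<Rightarrow> 'b::euclidean_space) \<Rightarrow> bool" where
  "Ck 0 f \<longleftrightarrow> continuous_on UNIV f"
| "Ck (Suc k) f \<longleftrightarrow> (\<forall>p. f differentiable (at p)) \<and>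
      (\<forall>v. Ck k (\<lambda>p. frechet_derivative f (at p) v))"

definition smooth :: "('a::euclidean_space \<Rightarrow> 'b::euclidean_space) \<Rightarrow> bool" where
  "smooth f \<longleftrightarrow> (\<forall>k. Ck k f)"

definition dir_deriv ::
    "'a::euclidean_space vfield \<Rightarrow> ('a \<Rightarrow> 'b::euclidean_space) \<Rightarrow> 'a \<Rightarrow> 'b" where
  "dir_deriv X f = (\<lambda>p. frechet_derivative f (at p) (X p))"

definition lie_bracket ::
    "'a::euclidean_space vfield \<Rightarrow> 'a vfield \<Rightarrow> 'a vfield" where
  "lie_bracket X Y = (\<lambda>p. dir_deriv X Y p - dir_deriv Y X p)"

section \<open>Connections\<close>

text \<open>Connections are constrained only on smooth vector fields; their values on
  other arguments are irrelevant.\<close>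

definition affine_connection ::
    "('a::euclidean_space vfield \<Rightarrow> 'a vfield \<Rightarrow> 'a vfield) \<Rightarrow> bool" where
  "affine_connection nabla \<longleftrightarrow>
     (\<forall>X Y. smooth X \<longrightarrow> smooth Y \<longrightarrow> smooth (nabla X Y)) \<and>
     (\<forall>X X' Y. smooth X \<longrightarrow> smooth X' \<longrightarrow> smooth Y \<longrightarrow>
        nabla (\<lambda>p. X p + X' p) Y = (\<lambda>p. nabla X Y p + nabla X' Y p)) \<and>
     (\<forall>(f::'a \<Rightarrow> real) X Y. smooth f \<longrightarrow> smooth X \<longrightarrow> smooth Y \<longrightarrow>
        nabla (\<lambda>p. f p *\<^sub>R X p) Y = (\<lambda>p. f p *\<^sub>R nabla X Y p)) \<and>
     (\<forall>X Y Y'. smooth X \<longrightarrow> smooth Y \<longrightarrow> smooth Y' \<longrightarrow>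
        nabla X (\<lambda>p. Y p + Y' p) = (\<lambda>p. nabla X Y p + nabla X Y' p)) \<and>
     (\<forall>(f::'a \<Rightarrow> real) X Y. smooth f \<longrightarrow> smooth X \<longrightarrow> smooth Y \<longrightarrow>
        nabla X (\<lambda>p. f p *\<^sub>R Y p) = (\<lambda>p. dir_deriv X f p *\<^sub>R Y p + f p *\<^sub>R nabla X Y p))"

definition torsion_free ::
    "('a::euclidean_space vfield \<Rightarrow> 'a vfield \<Rightarrow> 'a vfield) \<Rightarrow> bool" where
  "torsion_free nabla \<longleftrightarrow>
     (\<forall>X Y. smooth X \<longrightarrow> smooth Y \<longrightarrow>
        (\<lambda>p. nabla X Y p - nabla Y X p) = lie_bracket X Y)"

definition metric_compatible ::
    "'a::euclidean_space metric \<Rightarrow> ('a vfield \<Rightarrow> 'a vfield \<Rightarrow> 'a vfield) \<Rightarrow> bool" where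
  "metric_compatible g nabla \<longleftrightarrow>
     (\<forall>X Y Z. smooth X \<longrightarrow> smooth Y \<longrightarrow> smooth Z \<longrightarrow>
        dir_deriv X (\<lambda>p. g p (Y p) (Z p)) =
          (\<lambda>p. g p (nabla X Y p) (Z p) + g p (Y p) (nabla X Z p)))"

definition levi_civita ::
    "'a::euclidean_space metric \<Rightarrow> ('a vfield \<Rightarrow> 'a vfield \<Rightarrow> 'a vfield) \<Rightarrow> bool" where
  "levi_civita g nabla \<longleftrightarrow>
     affine_connection nabla \<and> torsion_free nabla \<and> metric_compatible g nabla"

section \<open>Killing and affine vector fields\<close>

definition lie_deriv_metric ::
    "'a::euclidean_space vfield \<Rightarrow> 'a metric \<Rightarrow> 'a vfield \<Rightarrow> 'a vfield \<Rightarrow> 'a \<Rightarrow> real" where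
  "lie_deriv_metric X g Y Z = (\<lambda>p. dir_deriv X (\<lambda>q. g q (Y q) (Z q)) p
      - g p (lie_bracket X Y p) (Z p) - g p (Y p) (lie_bracket X Z p))"

definition killing_field :: "'a::euclidean_space metric \<Rightarrow> 'a vfield \<Rightarrow> bool" where
  "killing_field g X \<longleftrightarrow>
     (\<forall>Y Z. smooth Y \<longrightarrow> smooth Z \<longrightarrow> lie_deriv_metric X g Y Z = (\<lambda>p. 0))"

definition affine_field ::
    "('a::euclidean_space vfield \<Rightarrow> 'a vfield \<Rightarrow> 'a vfield) \<Rightarrow> 'a vfield \<Rightarrow> bool" where
  "affine_field nabla X \<longleftrightarrow>
     (\<forall>Y Z. smooth Y \<longrightarrow> smooth Z \<longrightarrow>
        lie_bracket X (nabla Y Z) =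
          (\<lambda>p. nabla (lie_bracket X Y) Z p + nabla Y (lie_bracket X Z) p))"

section \<open>The Heisenberg group\<close>

type_synonym heis = "real \<times> real \<times> real"

fun heis_mult :: "heis \<Rightarrow> heis \<Rightarrow> heis" where
  "heis_mult (x, y, z) (x', y', z') = (x + x', y + y', z + z' - x * y')"

text \<open>\<open>heis_metric l p v w\<close> is the polarisation of
  \<open>dx\<^sup>2 / l\<^sup>2 + dy\<^sup>2 + (x dy + dz)\<^sup>2\<close> at \<open>p = (x, y, z)\<close>.\<close>

fun heis_metric :: "real \<Rightarrow> heis metric" where
  "heis_metric l (x, y, z) (a, b, c) (a', b', c') =
     a * a' / l\<^sup>2 + b * b' + (x * b + c) * (x * b' + c')"

lemma heis_mult_has_derivative:
  "(heis_mult p has_derivative (\<lambda>v. (fst v, fst (snd v), snd (snd v) - fst p * fst (snd v)))) (at q)"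
proof -
  have "heis_mult p = (\<lambda>q. (fst p + fst q, fst (snd p) + fst (snd q),
          snd (snd p) + snd (snd q) - fst p * fst (snd q)))"
    by (cases p) auto
  then show ?thesis
    by (auto intro!: derivative_eq_intros)
qed

lemma heis_metric_left_invariant:
  "heis_metric l (heis_mult p q) (frechet_derivative (heis_mult p) (at q) v)
     (frechet_derivative (heis_mult p) (at q) w) = heis_metric l q v w"
  unfolding frechet_derivative_at[OF heis_mult_has_derivative, symmetric]
  by (cases p; cases q; cases v; cases w) (simp add: algebra_simps)

section \<open>Existence of the Levi-Civita connection of the Heisenberg metric\<close>

lemma Ck_lower: "Ck (Suc k) f \<Longrightarrow> Ck k f"
proof (induction k arbitrary: f)
  case 0
  then show ?case
    by (auto intro!: continuous_at_imp_continuous_on differentiable_imp_continuous_within)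
next
  case (Suc k)
  then show ?case by (metis Ck.simps(2))
qed

lemma Ck_Suc_I:
  assumes "\<And>p. (f has_derivative f' p) (at p)" "\<And>v. Ck k (\<lambda>p. f' p v)"
  shows "Ck (Suc k) f"
proof -
  have "frechet_derivative f (at p) = f' p" for p
    using assms(1) frechet_derivative_at by metis
  then show ?thesis using assms by (auto intro: differentiableI)
qed

lemma Ck_Suc_D:
  assumes "Ck (Suc k) f"
  shows "(f has_derivative frechet_derivative f (at p)) (at p)"
    "Ck k (\<lambda>p. frechet_derivative f (at p) v)"
  using assms by (auto simp: frechet_derivative_works)

lemma Ck_const: "Ck k (\<lambda>p. c)"
  by (induction k arbitrary: c) (auto intro!: Ck_Suc_I[OF has_derivative_const] simp del: Ck.simps(2))

lemma Ck_add: "Ck k f \<Longrightarrow> Ck k g \<Longrightarrow> Ck k (\<lambda>p. f p + g p)"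
proof (induction k arbitrary: f g)
  case 0
  then show ?case by (auto intro: continuous_intros)
next
  case (Suc k)
  show ?case
    by (rule Ck_Suc_I[OF has_derivative_add[OF Ck_Suc_D(1)[OF Suc.prems(1)] Ck_Suc_D(1)[OF Suc.prems(2)]]])
      (intro Suc.IH Ck_Suc_D(2)[OF Suc.prems(1)] Ck_Suc_D(2)[OF Suc.prems(2)])
qed

lemma Ck_linear: "bounded_linear L \<Longrightarrow> Ck k f \<Longrightarrow> Ck k (\<lambda>p. L (f p))"
proof (induction k arbitrary: f)
  case 0
  then show ?case by (auto intro: bounded_linear.continuous_on)
next
  case (Suc k)
  show ?case
    by (rule Ck_Suc_I[OF bounded_linear.has_derivative[OF Suc.prems(1) Ck_Suc_D(1)[OF Suc.prems(2)]]])
      (intro Suc.IH Suc.prems(1) Ck_Suc_D(2)[OF Suc.prems(2)])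
qed

lemma Ck_scaleR: "Ck k f \<Longrightarrow> Ck k g \<Longrightarrow> Ck k (\<lambda>p. f p *\<^sub>R g p)"
proof (induction k arbitrary: f g)
  case 0
  then show ?case by (auto intro: continuous_intros)
next
  case (Suc k)
  show ?case
    by (rule Ck_Suc_I[OF has_derivative_scaleR[OF Ck_Suc_D(1)[OF Suc.prems(1)] Ck_Suc_D(1)[OF Suc.prems(2)]]])
      (intro Ck_add Suc.IH Ck_Suc_D(2)[OF Suc.prems(1)] Ck_Suc_D(2)[OF Suc.prems(2)] Ck_lower[OF Suc.prems(1)]
         Ck_lower[OF Suc.prems(2)])
qed

lemma Ck_id: "Ck k (\<lambda>p. p)"
  by (cases k) (auto intro!: Ck_Suc_I[OF has_derivative_ident] Ck_const simp del: Ck.simps(2))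

lemma smooth_const: "smooth (\<lambda>p. c)"
  and smooth_id: "smooth (\<lambda>p. p)"
  and smooth_add: "smooth f \<Longrightarrow> smooth g \<Longrightarrow> smooth (\<lambda>p. f p + g p)"
  and smooth_linear: "bounded_linear L \<Longrightarrow> smooth f \<Longrightarrow> smooth (\<lambda>p. L (f p))"
  and smooth_scaleR: "smooth h \<Longrightarrow> smooth f \<Longrightarrow> smooth (\<lambda>p. h p *\<^sub>R f p)"
  by (simp_all add: smooth_def Ck_const Ck_id Ck_add Ck_linear Ck_scaleR)

lemma smooth_mult: "smooth f \<Longrightarrow> smooth g \<Longrightarrow> smooth (\<lambda>p. f p * g p :: real)"
  using smooth_scaleR[of f g] by simp

lemma smooth_minus: "smooth f \<Longrightarrow> smooth (\<lambda>p. - f p)"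
  by (rule smooth_linear[OF bounded_linear_minus[OF bounded_linear_ident]])

lemma smooth_diff: "smooth f \<Longrightarrow> smooth g \<Longrightarrow> smooth (\<lambda>p. f p - g p)"
  using smooth_add[OF _ smooth_minus, of f g] by simp

lemma smooth_fst: "smooth f \<Longrightarrow> smooth (\<lambda>p. fst (f p))"
  and smooth_snd: "smooth f \<Longrightarrow> smooth (\<lambda>p. snd (f p))"
  by (auto intro: smooth_linear bounded_linear_fst bounded_linear_snd)

lemma smooth_Pair: 
  assumes "smooth f" "smooth g" shows "smooth (\<lambda>p. (f p, g p))"
proof -
  have "smooth (\<lambda>p. (f p, 0) + (0, g p))"
    by (intro smooth_add smooth_linear[of "\<lambda>u. (u, 0)"] smooth_linear[of "\<lambda>u. (0, u)"] assms
        bounded_linear_Pair bounded_linear_ident bounded_linear_zero)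
  then show ?thesis by simp
qed

lemma smooth_sum: "(\<And>i. i \<in> I \<Longrightarrow> smooth (f i)) \<Longrightarrow> smooth (\<lambda>p. \<Sum>i\<in>I. f i p)"
  by (induction I rule: infinite_finite_induct) (auto intro: smooth_add smooth_const)

lemma smooth_has_derivative:
  "smooth f \<Longrightarrow> (f has_derivative frechet_derivative f (at p)) (at p)"
  unfolding smooth_def using Ck_Suc_D(1) by blast

lemma smooth_frechet: "smooth f \<Longrightarrow> smooth (\<lambda>p. frechet_derivative f (at p) v)"
  unfolding smooth_def using Ck_Suc_D(2) by blast

lemma smooth_dir_deriv:
  assumes "smooth X" "smooth f" shows "smooth (dir_deriv X f)"
proof -
  have "dir_deriv X f = (\<lambda>p. \<Sum>b\<in>Basis. (X p \<bullet> b) *\<^sub>R frechet_derivative f (at p) b)"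
  proof
    fix p
    interpret bounded_linear "frechet_derivative f (at p)"
      using smooth_has_derivative[OF assms(2)] has_derivative_bounded_linear by blast
    have "frechet_derivative f (at p) (X p) =
        frechet_derivative f (at p) (\<Sum>b\<in>Basis. (X p \<bullet> b) *\<^sub>R b)"
      by (simp add: euclidean_representation)
    then show "dir_deriv X f p = (\<Sum>b\<in>Basis. (X p \<bullet> b) *\<^sub>R frechet_derivative f (at p) b)"
      by (simp add: dir_deriv_def sum scaleR)
  qed
  then show ?thesis
    using assms by (auto intro!: smooth_sum smooth_scaleR smooth_frechet
        smooth_linear[OF bounded_linear_inner_left])
qed

lemma dir_deriv_eqI:
  "(f has_derivative f') (at p) \<Longrightarrow> dir_deriv X f p = f' (X p)"
  by (simp add: dir_deriv_def frechet_derivative_at[symmetric])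

text \<open>The Christoffel symbols of \<open>heis_metric l\<close> in the coordinates \<open>(x, y, z)\<close>,
  as a symmetric bilinear map.\<close>

fun heis_christoffel :: "real \<Rightarrow> heis \<Rightarrow> heis \<Rightarrow> heis \<Rightarrow> heis" where
  "heis_christoffel l (x, y, z) (a, b, c) (a', b', c') =
    (let s = x * b + c; s' = x * b' + c'; t = (a * s' + s * a') / 2
     in (- (l\<^sup>2 / 2) * (b * s' + s * b'), t, (a * b' + b * a') / 2 - x * t))"

lemma levi_civita_heis_exists:
  assumes "0 < l"
  shows "\<exists>nabla. levi_civita (heis_metric l) nabla"
proof -
  let ?G = "heis_christoffel l"
  define nabla where "nabla = (\<lambda>X Y p. dir_deriv X Y p + ?G p (X p) (Y p))"
  have G: "?G p v w = (let x = fst p; a = fst v; b = fst (snd v); c = snd (snd v);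
      a' = fst w; b' = fst (snd w); c' = snd (snd w);
      s = x * b + c; s' = x * b' + c'; t = (a * s' + s * a') * (1/2)
     in ((- (l\<^sup>2 / 2)) * (b * s' + s * b'), t, (a * b' + b * a') * (1/2) - x * t))" for p v w
    by (cases p; cases v; cases w) (simp add: Let_def)
  have M: "heis_metric l p v w = fst v * fst w * inverse (l\<^sup>2) + fst (snd v) * fst (snd w)
      + (fst p * fst (snd v) + snd (snd v)) * (fst p * fst (snd w) + snd (snd w))" for p v w
    by (cases p; cases v; cases w) (simp add: divide_inverse)
  note D = smooth_has_derivative
  have lin: "linear (frechet_derivative f (at p))" if "smooth f" for f :: "heis \<Rightarrow> heis" and p
    using D[OF that] has_derivative_linear by blast
  have "affine_connection nabla"
    unfolding affine_connection_def
  proof (intro conjI allI impI)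
    fix X Y :: "heis vfield" assume [simp]: "smooth X" "smooth Y"
    show "smooth (nabla X Y)"
      unfolding nabla_def G Let_def
      by (intro smooth_add smooth_dir_deriv smooth_Pair smooth_mult smooth_diff smooth_fst
          smooth_snd smooth_const smooth_id) simp_all
  next
    fix X X' Y :: "heis vfield" assume s: "smooth X" "smooth X'" "smooth Y"
    show "nabla (\<lambda>p. X p + X' p) Y = (\<lambda>p. nabla X Y p + nabla X' Y p)"
      unfolding nabla_def dir_deriv_def G Let_def
      by (rule ext) (simp add: linear_add[OF lin[OF s(3)]] prod_eq_iff algebra_simps add_divide_distrib)
  next
    fix f :: "heis \<Rightarrow> real" and X Y :: "heis vfield" assume s: "smooth f" "smooth X" "smooth Y"
    show "nabla (\<lambda>p. f p *\<^sub>R X p) Y = (\<lambda>p. f p *\<^sub>R nabla X Y p)"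
      unfolding nabla_def dir_deriv_def G Let_def
      by (rule ext) (simp add: linear_scale[OF lin[OF s(3)]] prod_eq_iff algebra_simps add_divide_distrib)
  next
    fix X Y Y' :: "heis vfield" assume s: "smooth X" "smooth Y" "smooth Y'"
    have "dir_deriv X (\<lambda>p. Y p + Y' p) p = dir_deriv X Y p + dir_deriv X Y' p" for p
      by (subst dir_deriv_eqI[OF has_derivative_add[OF D[OF s(2)] D[OF s(3)]]]) (simp add: dir_deriv_def)
    then show "nabla X (\<lambda>p. Y p + Y' p) = (\<lambda>p. nabla X Y p + nabla X Y' p)"
      unfolding nabla_def G Let_def
      by (intro ext) (simp add: prod_eq_iff algebra_simps add_divide_distrib)
  next
    fix f :: "heis \<Rightarrow> real" and X Y :: "heis vfield" assume s: "smooth f" "smooth X" "smooth Y"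
    have "dir_deriv X (\<lambda>p. f p *\<^sub>R Y p) p = dir_deriv X f p *\<^sub>R Y p + f p *\<^sub>R dir_deriv X Y p" for p
      by (subst dir_deriv_eqI[OF has_derivative_scaleR[OF D[OF s(1)] D[OF s(3)]]]) (simp add: dir_deriv_def)
    then show "nabla X (\<lambda>p. f p *\<^sub>R Y p) = (\<lambda>p. dir_deriv X f p *\<^sub>R Y p + f p *\<^sub>R nabla X Y p)"
      unfolding nabla_def G Let_def
      by (intro ext) (simp add: prod_eq_iff algebra_simps add_divide_distrib)
  qed
  moreover have "torsion_free nabla"
    unfolding torsion_free_def nabla_def lie_bracket_def G Let_def
    by (auto simp: prod_eq_iff algebra_simps fun_eq_iff)
  moreover have "metric_compatible (heis_metric l) nabla"
    unfolding metric_compatible_def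
  proof (intro allI impI ext)
    fix X Y Z :: "heis vfield" and p assume s: "smooth X" "smooth Y" "smooth Z"
    note [derivative_intros] = D[OF s(2)] D[OF s(3)]
    show "dir_deriv X (\<lambda>p. heis_metric l p (Y p) (Z p)) p =
          heis_metric l p (nabla X Y p) (Z p) + heis_metric l p (Y p) (nabla X Z p)"
      unfolding M
      by (subst dir_deriv_eqI, (rule derivative_eq_intros refl)+)
        (use assms in \<open>simp add: nabla_def G Let_def dir_deriv_def field_simps power2_eq_square\<close>)
  qed
  ultimately show ?thesis unfolding levi_civita_def by blast
qed

end

(* Write A(Y, Z) = [X, nabla_Y Z] - nabla_[X,Y] Z - nabla_Y [X, Z]. This is symmetric by the Jacobi
identity; if X is Killing, then g(A(Y, Z), W) is skew in Z and W, and a trilinear form that is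
symmetric in the first two slots and skew in the last two vanishes, so X is affine.

Conversely, take a left-invariant orthonormal frame e_1, e_2, e_3 with [e_1, e_2] = - l e_3. For an
affine X the functions a_ij = g([X, e_i], e_j) satisfy a closed first-order linear system: each
e_i (a_jm) is a linear combination of the a's with constant coefficients. The integrability
condition [e_1, e_2] a_11 = - l e_3 (a_11) yields a_12 + a_21 = 0; differentiating this relation
makes a skew up to a multiple a_11 of the identity. The integrability condition for a_13 then gives
a_23 = 0, and differentiating again a_11 = 0. So a is skew, that is, X is Killing. *)

theory Submission
  imports Defs
begin

section \<open>Second derivatives and the Lie bracket\<close>

lemma smooth_imp_continuous_on: "smooth f \<Longrightarrow> continuous_on S f"
  unfolding smooth_def using Ck.simps(1) continuous_on_subset by blast

lemma smooth_mvt: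
  fixes f :: "'a::euclidean_space \<Rightarrow> real"
  assumes "smooth f" "0 < h"
  obtains t where "0 < t" "t < h"
    "f (p + h *\<^sub>R u) - f p = h * frechet_derivative f (at (p + t *\<^sub>R u)) u"
proof -
  have "((\<lambda>t. f (p + t *\<^sub>R u)) has_field_derivative frechet_derivative f (at (p + t *\<^sub>R u)) u) (at t)"
    for t :: real
  proof -
    let ?D = "frechet_derivative f (at (p + t *\<^sub>R u))"
    have f: "(f has_derivative ?D) (at (p + t *\<^sub>R u))"
      by (rule smooth_has_derivative[OF assms(1)])
    have "((\<lambda>t. p + t *\<^sub>R u) has_derivative (\<lambda>s. s *\<^sub>R u)) (at t)"
      by (auto intro!: derivative_eq_intros)
    from has_derivative_compose[OF this f]
    have "((\<lambda>t. f (p + t *\<^sub>R u)) has_derivative (\<lambda>s. ?D (s *\<^sub>R u))) (at t)" .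
    then show ?thesis
      unfolding has_field_derivative_def
      by (rule has_derivative_eq_rhs)
        (simp add: fun_eq_iff linear_scale[OF has_derivative_linear[OF f]])
  qed
  from MVT2[OF assms(2) this] that show thesis
    by fastforce
qed

lemma frechet_derivative_translate:
  "(f has_derivative frechet_derivative f (at (q + c))) (at (q + c)) \<Longrightarrow>
    ((\<lambda>q. f (q + c)) has_derivative frechet_derivative f (at (q + c))) (at q)"
  by (rule has_derivative_compose[of "\<lambda>q. q + c" "\<lambda>w. w" q UNIV f])
    (auto intro!: derivative_eq_intros)

lemma Ck_translate: "Ck k f \<Longrightarrow> Ck k (\<lambda>q. f (q + c))"
proof (induction k arbitrary: f)
  case 0
  then show ?case
    by (auto intro!: continuous_intros elim: continuous_on_compose2)
next
  case (Suc k)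
  show ?case
    by (rule Ck_Suc_I[OF frechet_derivative_translate[OF Ck_Suc_D(1)[OF Suc.prems]]])
      (rule Suc.IH[OF Ck_Suc_D(2)[OF Suc.prems]])
qed

lemma smooth_translate: "smooth f \<Longrightarrow> smooth (\<lambda>q. f (q + c))"
  by (simp add: smooth_def Ck_translate)

text \<open>The mean value theorem is applied twice: in direction \<open>u\<close> to the increment
  q -> f(q + h v) - f(q), then in direction \<open>v\<close> to the derivative of \<open>f\<close>
  along \<open>u\<close>. The left-hand side is symmetric in \<open>u\<close> and \<open>v\<close>,
  while the right-hand side differentiates along \<open>u\<close> first.\<close>

lemma second_difference_mvt:
  fixes f :: "'a::euclidean_space \<Rightarrow> real"
  assumes "smooth f" "0 < h"
  obtains t s where "0 < t" "t < h" "0 < s" "s < h"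
    "f (p + h *\<^sub>R u + h *\<^sub>R v) - f (p + h *\<^sub>R u) - (f (p + h *\<^sub>R v) - f p) =
      h * h * frechet_derivative (\<lambda>q. frechet_derivative f (at q) u) (at (p + t *\<^sub>R u + s *\<^sub>R v)) v"
proof -
  let ?F = "\<lambda>q. f (q + h *\<^sub>R v) - f q"
  let ?D = "\<lambda>q. frechet_derivative f (at q)"
  have shift: "((\<lambda>q. f (q + h *\<^sub>R v)) has_derivative ?D (q + h *\<^sub>R v)) (at q)" for q
    by (rule frechet_derivative_translate[OF smooth_has_derivative[OF assms(1)]])
  have "smooth (\<lambda>q. f (q + h *\<^sub>R v))"
    by (rule smooth_translate[OF assms(1)])
  then have F: "smooth ?F"
    using assms(1) by (rule smooth_diff)
  have "(?F has_derivative (\<lambda>w. ?D (q + h *\<^sub>R v) w - ?D q w)) (at q)" for q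
    by (intro has_derivative_diff shift smooth_has_derivative[OF assms(1)])
  then have DF: "frechet_derivative ?F (at q) w = ?D (q + h *\<^sub>R v) w - ?D q w" for q w
    by (subst frechet_derivative_at[symmetric]) auto
  obtain t where t: "0 < t" "t < h"
    "?F (p + h *\<^sub>R u) - ?F p = h * frechet_derivative ?F (at (p + t *\<^sub>R u)) u"
    by (rule smooth_mvt[OF F assms(2), where p = p and u = u])
  obtain s where s: "0 < s" "s < h"
    "?D (p + t *\<^sub>R u + h *\<^sub>R v) u - ?D (p + t *\<^sub>R u) u
      = h * frechet_derivative (\<lambda>q. ?D q u) (at (p + t *\<^sub>R u + s *\<^sub>R v)) v"
    by (rule smooth_mvt[OF smooth_frechet[OF assms(1), of u] assms(2), where p = "p + t *\<^sub>R u" and u = v])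
  show thesis
    by (rule that[OF t(1,2) s(1,2)]) (use t(3) s(3) in \<open>simp add: DF\<close>)
qed

text \<open>The second difference over a small parallelogram equals h^2 times either mixed
  derivative, each taken at some point near \<open>p\<close>. Continuity of both derivatives then
  forces equality at \<open>p\<close>.\<close>

lemma second_derivative_symmetric_real:
  fixes f :: "'a::euclidean_space \<Rightarrow> real"
  assumes f: "smooth f"
  shows "frechet_derivative (\<lambda>q. frechet_derivative f (at q) u) (at p) v =
    frechet_derivative (\<lambda>q. frechet_derivative f (at q) v) (at p) u"
proof -
  define A where "A = (\<lambda>x. frechet_derivative (\<lambda>q. frechet_derivative f (at q) u) (at x) v)"
  define B where "B = (\<lambda>x. frechet_derivative (\<lambda>q. frechet_derivative f (at q) v) (at x) u)"
  \<comment> \<open>The summand 0 gives the bound the form that \<open>field_le_epsilon\<close>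
    expects.\<close>
  have "\<bar>A p - B p\<bar> \<le> 0 + e" if "0 < e" for e :: real
  proof -
    have "continuous_on UNIV A" "continuous_on UNIV B"
      unfolding A_def B_def by (intro smooth_imp_continuous_on smooth_frechet f)+
    then have "isCont A p" "isCont B p"
      by (simp_all add: continuous_on_eq_continuous_at)
    then have "\<exists>d>0. \<forall>x. dist x p < d \<longrightarrow> dist (A x) (A p) < e / 2"
      "\<exists>d>0. \<forall>x. dist x p < d \<longrightarrow> dist (B x) (B p) < e / 2"
      using half_gt_zero[OF \<open>0 < e\<close>] unfolding continuous_at_eps_delta by blast+
    then obtain d1 d2 where d: "0 < d1" "0 < d2"
      "\<And>x. dist x p < d1 \<Longrightarrow> dist (A x) (A p) < e / 2"
      "\<And>x. dist x p < d2 \<Longrightarrow> dist (B x) (B p) < e / 2"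
      by auto
    \<comment> \<open>The 1 in the denominator keeps it positive when \<open>u\<close> and
      \<open>v\<close> vanish, and makes the distance bound below strict.\<close>
    define h where "h = min d1 d2 / (norm u + norm v + 1)"
    have N: "0 < norm u + norm v + 1"
      by (simp add: add_nonneg_pos)
    then have h: "0 < h"
      unfolding h_def using d by (intro divide_pos_pos) auto
    have near: "dist (p + t *\<^sub>R u + s *\<^sub>R v) p < min d1 d2" if "0 < t" "t < h" "0 < s" "s < h" for t s
    proof -
      have "dist (p + t *\<^sub>R u + s *\<^sub>R v) p = norm (t *\<^sub>R u + s *\<^sub>R v)"
        by (simp add: dist_norm)
      also have "\<dots> \<le> t * norm u + s * norm v"
        using that by (metis abs_of_pos norm_scaleR norm_triangle_ineq)
      also have "\<dots> \<le> h * norm u + h * norm v"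
        using that by (intro add_mono mult_right_mono) auto
      also have "\<dots> < h * (norm u + norm v + 1)"
        using h by (simp add: algebra_simps)
      also have "\<dots> = min d1 d2"
        using N by (simp add: h_def)
      finally show ?thesis .
    qed
    obtain t s where ts: "0 < t" "t < h" "0 < s" "s < h"
      "f (p + h *\<^sub>R u + h *\<^sub>R v) - f (p + h *\<^sub>R u) - (f (p + h *\<^sub>R v) - f p) =
        h * h * A (p + t *\<^sub>R u + s *\<^sub>R v)"
      unfolding A_def by (rule second_difference_mvt[OF f h])
    obtain t' s' where ts': "0 < t'" "t' < h" "0 < s'" "s' < h"
      "f (p + h *\<^sub>R v + h *\<^sub>R u) - f (p + h *\<^sub>R v) - (f (p + h *\<^sub>R u) - f p) =
        h * h * B (p + t' *\<^sub>R v + s' *\<^sub>R u)"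
      unfolding B_def by (rule second_difference_mvt[OF f h])
    \<comment> \<open>Exchanging \<open>u\<close> and \<open>v\<close> leaves the second difference
      unchanged up to the order of the summands, so both mean value formulas compute the same
      number.\<close>
    have "h * h * A (p + t *\<^sub>R u + s *\<^sub>R v) = h * h * B (p + s' *\<^sub>R u + t' *\<^sub>R v)"
      using ts(5) ts'(5) unfolding add.assoc[of p] add.commute[of "_ *\<^sub>R v" "_ *\<^sub>R u"]
      by (simp only:)
    then have "A (p + t *\<^sub>R u + s *\<^sub>R v) = B (p + s' *\<^sub>R u + t' *\<^sub>R v)"
      using h by simp
    moreover have "dist (A (p + t *\<^sub>R u + s *\<^sub>R v)) (A p) < e / 2"
      "dist (B (p + s' *\<^sub>R u + t' *\<^sub>R v)) (B p) < e / 2"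
      using near[of t s] near[of s' t'] ts ts' d(3,4) by auto
    ultimately show ?thesis
      unfolding dist_real_def by linarith
  qed
  then have "\<bar>A p - B p\<bar> \<le> 0"
    by (rule field_le_epsilon)
  then show ?thesis
    by (simp add: A_def B_def)
qed

lemma frechet_derivative_bounded_linear:
  assumes "bounded_linear L" "smooth f"
  shows "frechet_derivative (\<lambda>p. L (f p)) (at p) v = L (frechet_derivative f (at p) v)"
  using frechet_derivative_at[OF bounded_linear.has_derivative[OF assms(1)
      smooth_has_derivative[OF assms(2)]]] by metis

lemma second_derivative_symmetric:
  fixes f :: "'a::euclidean_space \<Rightarrow> 'b::euclidean_space"
  assumes f: "smooth f"
  shows "frechet_derivative (\<lambda>q. frechet_derivative f (at q) u) (at p) v =
    frechet_derivative (\<lambda>q. frechet_derivative f (at q) v) (at p) u"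
proof (rule euclidean_eqI)
  fix b :: 'b
  have L: "bounded_linear (\<lambda>x. x \<bullet> b)"
    by (rule bounded_linear_inner_left)
  have "frechet_derivative (\<lambda>q. frechet_derivative f (at q) u) (at p) v \<bullet> b =
      frechet_derivative (\<lambda>q. frechet_derivative (\<lambda>q. f q \<bullet> b) (at q) u) (at p) v" for u v
    by (simp only: frechet_derivative_bounded_linear[OF L f]
        frechet_derivative_bounded_linear[OF L smooth_frechet[OF f]])
  with second_derivative_symmetric_real[OF smooth_linear[OF L f]]
  show "frechet_derivative (\<lambda>q. frechet_derivative f (at q) u) (at p) v \<bullet> b =
      frechet_derivative (\<lambda>q. frechet_derivative f (at q) v) (at p) u \<bullet> b"
    by simp
qed

section \<open>Calculus of directional derivatives, commutators and the Jacobi identity\<close>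

lemma dir_deriv_const: "dir_deriv X (\<lambda>p. c) = (\<lambda>p. 0)"
  by (rule ext) (simp add: dir_deriv_eqI[OF has_derivative_const])

lemma dir_deriv_diff:
  assumes "smooth f" "smooth h"
  shows "dir_deriv X (\<lambda>p. f p - h p) = (\<lambda>p. dir_deriv X f p - dir_deriv X h p)"
  by (rule ext, subst dir_deriv_eqI[OF has_derivative_diff[OF
    smooth_has_derivative[OF assms(1)] smooth_has_derivative[OF assms(2)]]])
   (simp add: dir_deriv_def)

lemma dir_deriv_add:
  assumes "smooth f" "smooth h"
  shows "dir_deriv X (\<lambda>p. f p + h p) = (\<lambda>p. dir_deriv X f p + dir_deriv X h p)"
  by (rule ext, subst dir_deriv_eqI[OF has_derivative_add[OF
    smooth_has_derivative[OF assms(1)] smooth_has_derivative[OF assms(2)]]])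
   (simp add: dir_deriv_def)

lemma dir_deriv_scaleR:
  assumes "smooth f" "smooth h"
  shows "dir_deriv X (\<lambda>p. f p *\<^sub>R h p) = (\<lambda>p. f p *\<^sub>R dir_deriv X h p + dir_deriv X f p *\<^sub>R h p)"
  by (rule ext, subst dir_deriv_eqI[OF has_derivative_scaleR[OF
    smooth_has_derivative[OF assms(1)] smooth_has_derivative[OF assms(2)]]])
   (simp add: dir_deriv_def)

lemma dir_deriv_cmult:
  fixes f :: "'a::euclidean_space \<Rightarrow> real"
  assumes "smooth f"
  shows "dir_deriv X (\<lambda>p. c * f p) = (\<lambda>p. c * dir_deriv X f p)"
  using dir_deriv_scaleR[OF smooth_const[of c] assms, of X] by (simp add: dir_deriv_const)

lemma dir_deriv_mult:
  fixes f h :: "'a::euclidean_space \<Rightarrow> real"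
  assumes "smooth f" "smooth h"
  shows "dir_deriv X (\<lambda>p. f p * h p) = (\<lambda>p. f p * dir_deriv X h p + dir_deriv X f p * h p)"
  using dir_deriv_scaleR[OF assms] by simp

lemma linear_frechet_derivative: "smooth f \<Longrightarrow> linear (frechet_derivative f (at p))"
  using smooth_has_derivative has_derivative_linear by blast

lemma dir_deriv_add_field:
  "smooth f \<Longrightarrow> dir_deriv (\<lambda>p. X p + Y p) f = (\<lambda>p. dir_deriv X f p + dir_deriv Y f p)"
  by (simp add: dir_deriv_def linear_add[OF linear_frechet_derivative] fun_eq_iff)

lemma dir_deriv_scaleR_field:
  "smooth f \<Longrightarrow> dir_deriv (\<lambda>p. h p *\<^sub>R X p) f = (\<lambda>p. h p *\<^sub>R dir_deriv X f p)"
  by (simp add: dir_deriv_def linear_scale[OF linear_frechet_derivative] fun_eq_iff)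

lemma dir_deriv_diff_field:
  "smooth f \<Longrightarrow> dir_deriv (\<lambda>p. X p - Y p) f = (\<lambda>p. dir_deriv X f p - dir_deriv Y f p)"
  by (simp add: dir_deriv_def linear_diff[OF linear_frechet_derivative] fun_eq_iff)

lemma dir_deriv_basis:
  assumes "smooth f"
  shows "dir_deriv X f p = (\<Sum>b\<in>Basis. (X p \<bullet> b) *\<^sub>R frechet_derivative f (at p) b)"
proof -
  have "frechet_derivative f (at p) (X p) =
      frechet_derivative f (at p) (\<Sum>b\<in>Basis. (X p \<bullet> b) *\<^sub>R b)"
    by (simp add: euclidean_representation)
  then show ?thesis
    by (simp add: dir_deriv_def linear_sum[OF linear_frechet_derivative[OF assms]]
      linear_scale[OF linear_frechet_derivative[OF assms]])
qed

text \<open>Product rule for X(Y f): one term differentiates \<open>Y\<close>, the other is the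
  second derivative of \<open>f\<close> with \<open>Y\<close> frozen at \<open>p\<close>. The second
  term is symmetric in \<open>X\<close> and \<open>Y\<close>, so it drops out of
  commutators.\<close>

lemma dir_deriv_dir_deriv:
  assumes "smooth Y" "smooth f"
  shows "dir_deriv X (dir_deriv Y f) p = frechet_derivative f (at p) (dir_deriv X Y p) +
    frechet_derivative (\<lambda>q. frechet_derivative f (at q) (Y p)) (at p) (X p)"
proof -
  let ?D = "\<lambda>q. frechet_derivative f (at q)"
  \<comment> \<open>Expanding \<open>Y\<close> in the basis leaves derivatives along fixed
    directions, which are smooth functions and can be differentiated term by term.\<close>
  have Yf: "dir_deriv Y f = (\<lambda>q. \<Sum>b\<in>Basis. (Y q \<bullet> b) *\<^sub>R ?D q b)"
    using dir_deriv_basis[OF assms(2)] by blast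
  have *: "(dir_deriv Y f has_derivative (\<lambda>v. \<Sum>b\<in>Basis.
      (Y p \<bullet> b) *\<^sub>R frechet_derivative (\<lambda>q. ?D q b) (at p) v
      + (frechet_derivative Y (at p) v \<bullet> b) *\<^sub>R ?D p b)) (at p)"
    unfolding Yf
    by (intro has_derivative_sum has_derivative_scaleR has_derivative_inner_left
      smooth_has_derivative smooth_frechet assms)
  \<comment> \<open>The sum runs over the inner direction of differentiation. Symmetry moves it to
    the outer one, where linearity of the derivative collapses it.\<close>
  have 1: "(\<Sum>b\<in>Basis. (Y p \<bullet> b) *\<^sub>R frechet_derivative (\<lambda>q. ?D q b) (at p) v)
     = frechet_derivative (\<lambda>q. ?D q (Y p)) (at p) v" for v
    using dir_deriv_basis[OF smooth_frechet[OF assms(2), of v], of Y p]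
    unfolding dir_deriv_def by (simp add: second_derivative_symmetric[OF assms(2), of v])
  have 2: "(\<Sum>b\<in>Basis. (frechet_derivative Y (at p) v \<bullet> b) *\<^sub>R ?D p b)
     = ?D p (frechet_derivative Y (at p) v)" for v
    using dir_deriv_basis[OF assms(2), of "\<lambda>_. frechet_derivative Y (at p) v" p]
    unfolding dir_deriv_def by simp
  show ?thesis
    by (subst dir_deriv_eqI[OF *]) (simp add: sum.distrib 1 2 dir_deriv_def add.commute)
qed

lemma dir_deriv_lie_bracket:
  assumes "smooth X" "smooth Y" "smooth f"
  shows "dir_deriv (lie_bracket X Y) f p =
    dir_deriv X (dir_deriv Y f) p - dir_deriv Y (dir_deriv X f) p"
  unfolding dir_deriv_dir_deriv[OF assms(2,3)] dir_deriv_dir_deriv[OF assms(1,3)]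
    second_derivative_symmetric[OF assms(3), of "X p"]
  unfolding lie_bracket_def dir_deriv_diff_field[OF assms(3)]
  by (simp add: dir_deriv_def[of "dir_deriv _ _"])

lemma smooth_lie_bracket: "smooth X \<Longrightarrow> smooth Y \<Longrightarrow> smooth (lie_bracket X Y)"
  unfolding lie_bracket_def by (intro smooth_diff smooth_dir_deriv)

text \<open>Vector fields are themselves vector-valued functions, so
  \<open>dir_deriv_lie_bracket\<close> applies to them. Both sides then expand into the same
  iterated derivatives.\<close>

lemma lie_bracket_jacobi:
  assumes "smooth X" "smooth Y" "smooth Z"
  shows "lie_bracket X (lie_bracket Y Z) p =
    lie_bracket (lie_bracket X Y) Z p + lie_bracket Y (lie_bracket X Z) p"
proof -
  have bracket: "dir_deriv U (lie_bracket V W) p = dir_deriv U (dir_deriv V W) p - dir_deriv U (dir_deriv W V) p"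
    if "smooth V" "smooth W" for U V W :: "'a vfield"
    using dir_deriv_diff[OF smooth_dir_deriv[OF that] smooth_dir_deriv[OF that(2,1)], of U]
    by (simp add: lie_bracket_def[abs_def])
  have unfold: "lie_bracket U V p = dir_deriv U V p - dir_deriv V U p" for U V :: "'a vfield"
    by (simp add: lie_bracket_def)
  show ?thesis
    unfolding unfold[of _ "lie_bracket _ _"] unfold[of "lie_bracket _ _"]
    using assms by (simp add: bracket dir_deriv_lie_bracket)
qed

section \<open>Killing fields are affine\<close>

lemma lie_bracket_add_right:
  assumes "smooth X" "smooth Y" "smooth Z"
  shows "lie_bracket X (\<lambda>p. Y p + Z p) p = lie_bracket X Y p + lie_bracket X Z p"
  by (simp add: lie_bracket_def dir_deriv_add dir_deriv_add_field assms)

text \<open>Smoothness of the metric is expressed by testing on smooth fields, because a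
  \<open>metric\<close> is a bare function of the point and of two tangent vectors.\<close>

locale riemannian_connection =
  fixes g :: "'a::euclidean_space metric"
    and nabla :: "'a vfield \<Rightarrow> 'a vfield \<Rightarrow> 'a vfield"
  assumes levi_civita: "levi_civita g nabla"
    and smooth_metric: "smooth Y \<Longrightarrow> smooth Z \<Longrightarrow> smooth (\<lambda>p. g p (Y p) (Z p))"
    and bilinear_metric: "bilinear (g p)"
    and metric_commute: "g p v w = g p w v"
    and metric_eq_0D: "g p v v = 0 \<Longrightarrow> v = 0"
begin

lemma smooth_nabla: "smooth Y \<Longrightarrow> smooth Z \<Longrightarrow> smooth (nabla Y Z)"
  and nabla_add_left: "smooth Y \<Longrightarrow> smooth Y' \<Longrightarrow> smooth Z \<Longrightarrow>
    nabla (\<lambda>p. Y p + Y' p) Z = (\<lambda>p. nabla Y Z p + nabla Y' Z p)"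
  and nabla_scaleR_left: "smooth f \<Longrightarrow> smooth Y \<Longrightarrow> smooth Z \<Longrightarrow>
    nabla (\<lambda>p. f p *\<^sub>R Y p) Z = (\<lambda>p. f p *\<^sub>R nabla Y Z p)"
  using levi_civita unfolding levi_civita_def affine_connection_def by blast+

lemma nabla_commute:
  assumes "smooth Y" "smooth Z"
  shows "nabla Y Z p = nabla Z Y p + lie_bracket Y Z p"
proof -
  have "(\<lambda>p. nabla Y Z p - nabla Z Y p) = lie_bracket Y Z"
    using levi_civita assms unfolding levi_civita_def torsion_free_def by blast
  from fun_cong[OF this, of p] show ?thesis
    by (simp add: algebra_simps)
qed

lemma dir_deriv_metric:
  "smooth Y \<Longrightarrow> smooth Z \<Longrightarrow> smooth W \<Longrightarrow> dir_deriv Y (\<lambda>p. g p (Z p) (W p)) =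
    (\<lambda>p. g p (nabla Y Z p) (W p) + g p (Z p) (nabla Y W p))"
  using levi_civita unfolding levi_civita_def metric_compatible_def by blast

lemmas metric_linear =
  bilinear_ladd[OF bilinear_metric] bilinear_radd[OF bilinear_metric]
  bilinear_lsub[OF bilinear_metric] bilinear_rsub[OF bilinear_metric]
  bilinear_lmul[OF bilinear_metric] bilinear_rmul[OF bilinear_metric]
  bilinear_lzero[OF bilinear_metric] bilinear_rzero[OF bilinear_metric]

lemma metric_sum_left: "g p (\<Sum>i\<in>I. f i) w = (\<Sum>i\<in>I. g p (f i) w)"
  by (induction I rule: infinite_finite_induct) (simp_all add: metric_linear)

lemma metric_sum_right: "g p w (\<Sum>i\<in>I. f i) = (\<Sum>i\<in>I. g p w (f i))"
  by (induction I rule: infinite_finite_induct) (simp_all add: metric_linear)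

text \<open>Metric compatibility expands the three derivatives into six connection terms;
  torsion-freeness pairs these so that all but the left-hand side cancel against the brackets. This
  determines the connection from brackets and inner products.\<close>

lemma koszul:
  assumes "smooth Y" "smooth Z" "smooth W"
  shows "2 * g p (nabla Y Z p) (W p) =
    dir_deriv Y (\<lambda>p. g p (Z p) (W p)) p + dir_deriv Z (\<lambda>p. g p (Y p) (W p)) p
    - dir_deriv W (\<lambda>p. g p (Y p) (Z p)) p + g p (lie_bracket Y Z p) (W p)
    - g p (lie_bracket Y W p) (Z p) - g p (lie_bracket Z W p) (Y p)"
  by (simp add: dir_deriv_metric assms nabla_commute[OF assms(1,2)]
    nabla_commute[OF assms(1,3)] nabla_commute[OF assms(2,3)] metric_linear
    metric_commute[of p "Y p"] metric_commute[of p "Z p"])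

lemma killing_fieldD:
  assumes "killing_field g X" "smooth Y" "smooth Z"
  shows "dir_deriv X (\<lambda>p. g p (Y p) (Z p)) =
    (\<lambda>p. g p (lie_bracket X Y p) (Z p) + g p (Y p) (lie_bracket X Z p))"
proof
  fix p
  have "lie_deriv_metric X g Y Z = (\<lambda>p. 0)"
    using assms unfolding killing_field_def by blast
  from fun_cong[OF this, of p] show "dir_deriv X (\<lambda>p. g p (Y p) (Z p)) p =
      g p (lie_bracket X Y p) (Z p) + g p (Y p) (lie_bracket X Z p)"
    by (simp add: lie_deriv_metric_def)
qed

text \<open>The Lie derivative of the connection along \<open>X\<close>, written A(Y, Z) in the
  overview; \<open>X\<close> is affine when it vanishes on smooth fields.\<close>

definition lie_deriv_nabla :: "'a vfield \<Rightarrow> 'a vfield \<Rightarrow> 'a vfield \<Rightarrow> 'a vfield" where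
  "lie_deriv_nabla X Y Z = (\<lambda>p. lie_bracket X (nabla Y Z) p
    - nabla (lie_bracket X Y) Z p - nabla Y (lie_bracket X Z) p)"

lemma smooth_lie_deriv_nabla:
  "smooth X \<Longrightarrow> smooth Y \<Longrightarrow> smooth Z \<Longrightarrow> smooth (lie_deriv_nabla X Y Z)"
  unfolding lie_deriv_nabla_def by (intro smooth_diff smooth_nabla smooth_lie_bracket)

text \<open>By torsion-freeness the difference of the two sides is [X, [Y, Z]] - [[X, Y], Z] - [Y,
  [X, Z]], which is zero by the Jacobi identity.\<close>

lemma lie_deriv_nabla_commute:
  assumes "smooth X" "smooth Y" "smooth Z"
  shows "lie_deriv_nabla X Y Z p = lie_deriv_nabla X Z Y p"
proof -
  have "nabla Y Z = (\<lambda>p. nabla Z Y p + lie_bracket Y Z p)"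
    using nabla_commute[OF assms(2,3)] by blast
  then have "lie_bracket X (nabla Y Z) p =
      lie_bracket X (nabla Z Y) p + lie_bracket X (lie_bracket Y Z) p"
    using lie_bracket_add_right[OF assms(1) smooth_nabla[OF assms(3,2)]
      smooth_lie_bracket[OF assms(2,3)]] by simp
  then show ?thesis
    unfolding lie_deriv_nabla_def lie_bracket_jacobi[OF assms]
    by (simp add: nabla_commute[of "lie_bracket X Y" Z] nabla_commute[of Y "lie_bracket X Z"]
      smooth_lie_bracket assms)
qed

text \<open>The function g(Z, W) is differentiated along [X, Y] in two ways: by metric
  compatibility, and as the commutator of X and Y. In the commutator the Killing property handles X,
  metric compatibility handles Y, and the mixed terms cancel.\<close>

lemma lie_deriv_nabla_skew:
  assumes "killing_field g X" "smooth X" "smooth Y" "smooth Z" "smooth W"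
  shows "g p (lie_deriv_nabla X Y Z p) (W p) + g p (Z p) (lie_deriv_nabla X Y W p) = 0"
proof -
  note [simp] = assms(2-) smooth_nabla smooth_lie_bracket smooth_metric
  let ?f = "\<lambda>p. g p (Z p) (W p)"
  have "dir_deriv (lie_bracket X Y) ?f p =
      dir_deriv X (dir_deriv Y ?f) p - dir_deriv Y (dir_deriv X ?f) p"
    by (intro dir_deriv_lie_bracket) simp_all
  moreover have "dir_deriv X (dir_deriv Y ?f) p =
      g p (lie_bracket X (nabla Y Z) p) (W p) + g p (nabla Y Z p) (lie_bracket X W p)
      + (g p (lie_bracket X Z p) (nabla Y W p) + g p (Z p) (lie_bracket X (nabla Y W) p))"
    by (simp add: dir_deriv_metric[of Y] dir_deriv_add killing_fieldD[OF assms(1)])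
  moreover have "dir_deriv Y (dir_deriv X ?f) p =
      g p (nabla Y (lie_bracket X Z) p) (W p) + g p (lie_bracket X Z p) (nabla Y W p)
      + (g p (nabla Y Z p) (lie_bracket X W p) + g p (Z p) (nabla Y (lie_bracket X W) p))"
    by (simp add: killing_fieldD[OF assms(1)] dir_deriv_add dir_deriv_metric[of Y])
  ultimately show ?thesis
    by (simp add: dir_deriv_metric[of "lie_bracket X Y"] lie_deriv_nabla_def metric_linear)
qed

lemma killing_imp_affine:
  assumes "killing_field g X" "smooth X"
  shows "affine_field nabla X"
  unfolding affine_field_def
proof (intro allI impI ext)
  fix Y Z :: "'a vfield" and p assume s: "smooth Y" "smooth Z"
  \<comment> \<open>With this choice A(Y, Z) paired with \<open>W\<close> is g(W, W), so
    definiteness applies.\<close>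
  define W where "W = lie_deriv_nabla X Y Z"
  have W: "smooth W"
    unfolding W_def by (intro smooth_lie_deriv_nabla assms(2) s)
  let ?A = "\<lambda>Y Z W. g p (lie_deriv_nabla X Y Z p) (W p)"
  have skew: "?A U V U' = - ?A U U' V" if "smooth U" "smooth V" "smooth U'" for U V U'
    using lie_deriv_nabla_skew[OF assms that, of p] metric_commute[of p "V p"] by simp
  have commute: "?A U V U' = ?A V U U'" if "smooth U" "smooth V" for U V U'
    by (simp add: lie_deriv_nabla_commute[OF assms(2) that])
  \<comment> \<open>Alternating the two exchanges gives A(Y,Z,W) = -A(Y,W,Z) = -A(W,Y,Z) = A(W,Z,Y)
    = A(Z,W,Y) = -A(Z,Y,W) = -A(Y,Z,W).\<close>
  have "?A Y Z W = - ?A Y Z W"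
    using s W by (metis skew commute)
  then have "W p = 0"
    using metric_eq_0D[of p "W p"] by (simp add: W_def)
  then show "lie_bracket X (nabla Y Z) p =
      nabla (lie_bracket X Y) Z p + nabla Y (lie_bracket X Z) p"
    by (simp add: W_def lie_deriv_nabla_def algebra_simps)
qed

end

section \<open>Orthonormal frames with constant structure functions\<close>

lemma lie_bracket_scaleR_right:
  assumes "smooth X" "smooth Y" "smooth f"
  shows "lie_bracket X (\<lambda>p. f p *\<^sub>R Y p) p = f p *\<^sub>R lie_bracket X Y p + dir_deriv X f p *\<^sub>R Y p"
  by (simp add: lie_bracket_def dir_deriv_scaleR dir_deriv_scaleR_field assms algebra_simps)

lemma lie_bracket_zero_right: "smooth X \<Longrightarrow> lie_bracket X (\<lambda>p. 0) p = 0"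
  by (simp add: lie_bracket_def dir_deriv_const)
    (simp add: dir_deriv_def linear_0[OF linear_frechet_derivative])

lemma lie_bracket_sum_right:
  assumes "smooth X" "\<And>i. i \<in> I \<Longrightarrow> smooth (F i)"
  shows "lie_bracket X (\<lambda>p. \<Sum>i\<in>I. F i p) p = (\<Sum>i\<in>I. lie_bracket X (F i) p)"
  using assms(2)
proof (induction I rule: infinite_finite_induct)
  case (insert i I)
  then have "smooth (\<lambda>p. \<Sum>i\<in>I. F i p)"
    by (intro smooth_sum) simp
  with insert assms(1) show ?case
    by (simp add: lie_bracket_add_right)
qed (simp_all add: lie_bracket_zero_right assms(1))

context riemannian_connection
begin

lemma nabla_sum_left:
  assumes "smooth Z" "\<And>i. i \<in> I \<Longrightarrow> smooth (Y i)"
  shows "nabla (\<lambda>p. \<Sum>i\<in>I. Y i p) Z p = (\<Sum>i\<in>I. nabla (Y i) Z p)"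
  using assms(2)
proof (induction I rule: infinite_finite_induct)
  case (insert i I)
  then have "smooth (\<lambda>p. \<Sum>i\<in>I. Y i p)"
    by (intro smooth_sum) simp
  with insert assms(1) show ?case
    by (simp add: nabla_add_left)
\<comment> \<open>Empty and infinite sums are the zero field; as a zero multiple of itself it has
  zero connection term.\<close>
qed (use nabla_scaleR_left[of "\<lambda>_. 0" "\<lambda>_. 0" Z] in \<open>simp_all add: smooth_const assms(1)\<close>)

lemma lie_deriv_metric_commute: "lie_deriv_metric X g Y Z = lie_deriv_metric X g Z Y"
  by (simp add: lie_deriv_metric_def metric_commute[of _ "Z _"]
    metric_commute[of _ "lie_bracket X Z _"] algebra_simps)

lemma lie_deriv_metric_scaleR_left:
  assumes "smooth X" "smooth f" "smooth Y" "smooth Z"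
  shows "lie_deriv_metric X g (\<lambda>p. f p *\<^sub>R Y p) Z p = f p * lie_deriv_metric X g Y Z p"
  by (simp add: lie_deriv_metric_def metric_linear dir_deriv_mult smooth_metric
    lie_bracket_scaleR_right assms algebra_simps)

lemma lie_deriv_metric_sum_left:
  assumes "smooth X" "smooth Z" "\<And>i. i \<in> I \<Longrightarrow> smooth (Y i)"
  shows "lie_deriv_metric X g (\<lambda>p. \<Sum>i\<in>I. Y i p) Z p = (\<Sum>i\<in>I. lie_deriv_metric X g (Y i) Z p)"
  using assms(3)
proof (induction I rule: infinite_finite_induct)
  case (insert i I)
  then have "smooth (\<lambda>p. \<Sum>i\<in>I. Y i p)"
    by (intro smooth_sum) simp
  with insert assms(1,2) show ?case
    by (simp add: lie_deriv_metric_def metric_linear dir_deriv_add smooth_metric lie_bracket_add_right)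
qed (simp_all add: lie_deriv_metric_def lie_bracket_zero_right assms(1) metric_linear dir_deriv_const)

end

text \<open>The numbers \<open>c\<close> do not depend on the point, as for a left-invariant frame
  on a Lie group. This is what gives the system below constant coefficients.\<close>

locale orthonormal_frame = riemannian_connection g nabla
  for g :: "'a::euclidean_space metric" and nabla +
  fixes I :: "'i set" and e :: "'i \<Rightarrow> 'a vfield" and c :: "'i \<Rightarrow> 'i \<Rightarrow> 'i \<Rightarrow> real"
  assumes smooth_frame: "i \<in> I \<Longrightarrow> smooth (e i)"
    and orthonormal: "i \<in> I \<Longrightarrow> j \<in> I \<Longrightarrow> g p (e i p) (e j p) = (if i = j then 1 else 0)"
    and expansion: "v = (\<Sum>i\<in>I. g p v (e i p) *\<^sub>R e i p)"
    and structure_constants: "i \<in> I \<Longrightarrow> j \<in> I \<Longrightarrow> k \<in> I \<Longrightarrow>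
      g p (lie_bracket (e i) (e j) p) (e k p) = c i j k"
begin

text \<open>Half the right-hand side of the Koszul formula on frame fields, where the derivative
  terms vanish because inner products of frame fields are constant.\<close>

definition conn_coeff :: "'i \<Rightarrow> 'i \<Rightarrow> 'i \<Rightarrow> real" where
  "conn_coeff i j k = (c i j k - c i k j - c j k i) / 2"

lemma frame_connection:
  assumes "i \<in> I" "j \<in> I" "k \<in> I"
  shows "g p (nabla (e i) (e j) p) (e k p) = conn_coeff i j k"
  using koszul[OF assms[THEN smooth_frame], of p]
  by (simp add: conn_coeff_def structure_constants orthonormal dir_deriv_const assms)

lemma nabla_frame:
  assumes "i \<in> I" "j \<in> I"
  shows "nabla (e i) (e j) = (\<lambda>p. \<Sum>k\<in>I. conn_coeff i j k *\<^sub>R e k p)"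
proof
  fix p
  show "nabla (e i) (e j) p = (\<Sum>k\<in>I. conn_coeff i j k *\<^sub>R e k p)"
    by (subst expansion[of _ p]) (simp add: frame_connection assms)
qed

text \<open>The functions a_ij of the overview.\<close>

definition bracket_coeff :: "'a vfield \<Rightarrow> 'i \<Rightarrow> 'i \<Rightarrow> 'a \<Rightarrow> real" where
  "bracket_coeff X i j = (\<lambda>p. g p (lie_bracket X (e i) p) (e j p))"

lemma smooth_bracket_coeff: "smooth X \<Longrightarrow> i \<in> I \<Longrightarrow> j \<in> I \<Longrightarrow> smooth (bracket_coeff X i j)"
  unfolding bracket_coeff_def by (intro smooth_metric smooth_lie_bracket smooth_frame)

text \<open>Metric compatibility splits the derivative into a term with nabla_{e_i} [X, e_j] and one
  with nabla_{e_i} e_m. Affinity rewrites the first through [X, nabla_{e_i} e_j] and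
  nabla_{[X, e_i]} e_j, and expansion in the frame closes the system.\<close>

lemma affine_field_bracket_coeff:
  assumes "affine_field nabla X" "smooth X" "i \<in> I" "j \<in> I" "m \<in> I"
  shows "dir_deriv (e i) (bracket_coeff X j m) p = (\<Sum>k\<in>I. conn_coeff i j k * bracket_coeff X k m p
    + conn_coeff i m k * bracket_coeff X j k p - bracket_coeff X i k p * conn_coeff k j m)"
proof -
  note [simp] = assms(2-) smooth_frame smooth_lie_bracket
  have "lie_bracket X (nabla (e i) (e j)) =
      (\<lambda>p. nabla (lie_bracket X (e i)) (e j) p + nabla (e i) (lie_bracket X (e j)) p)"
    using assms(1) smooth_frame assms(3,4) unfolding affine_field_def by blast
  then have "g p (lie_bracket X (nabla (e i) (e j)) p) (e m p) =
      g p (nabla (lie_bracket X (e i)) (e j) p) (e m p)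
      + g p (nabla (e i) (lie_bracket X (e j)) p) (e m p)"
    by (simp add: metric_linear)
  moreover have "lie_bracket X (nabla (e i) (e j)) p =
      (\<Sum>k\<in>I. conn_coeff i j k *\<^sub>R lie_bracket X (e k) p)"
    by (simp add: nabla_frame lie_bracket_sum_right smooth_scaleR smooth_const
      lie_bracket_scaleR_right dir_deriv_const)
  moreover have "nabla (lie_bracket X (e i)) (e j) p =
      (\<Sum>k\<in>I. bracket_coeff X i k p *\<^sub>R nabla (e k) (e j) p)"
  proof -
    have "lie_bracket X (e i) = (\<lambda>p. \<Sum>k\<in>I. bracket_coeff X i k p *\<^sub>R e k p)"
      unfolding bracket_coeff_def using expansion by blast
    then show ?thesis
      by (simp add: nabla_sum_left nabla_scaleR_left smooth_scaleR smooth_bracket_coeff)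
  qed
  moreover have "dir_deriv (e i) (bracket_coeff X j m) p =
      g p (nabla (e i) (lie_bracket X (e j)) p) (e m p)
      + g p (lie_bracket X (e j) p) (nabla (e i) (e m) p)"
    unfolding bracket_coeff_def by (simp add: dir_deriv_metric)
  ultimately show ?thesis
    by (simp add: metric_sum_left metric_sum_right metric_linear frame_connection nabla_frame[of i m]
      bracket_coeff_def sum.distrib sum_subtractf)
qed

text \<open>The Lie derivative of the metric is tensorial, so it suffices to test it on the frame.
  There inner products are constant and its value is -(a_ij + a_ji).\<close>

lemma killing_fieldI:
  assumes "smooth X" "\<And>i j p. i \<in> I \<Longrightarrow> j \<in> I \<Longrightarrow> bracket_coeff X i j p + bracket_coeff X j i p = 0"
  shows "killing_field g X"
  unfolding killing_field_def
proof (intro allI impI ext)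
  fix Y Z :: "'a vfield" and p assume s: "smooth Y" "smooth Z"
  note [simp] = s assms(1) smooth_frame smooth_metric smooth_scaleR
  have frame: "lie_deriv_metric X g (e i) (e j) p = 0" if "i \<in> I" "j \<in> I" for i j
    using assms(2)[OF that, of p] metric_commute[of p "e i p"]
    by (simp add: lie_deriv_metric_def orthonormal that dir_deriv_const bracket_coeff_def)
  have reduce: "lie_deriv_metric X g V W p =
      (\<Sum>i\<in>I. g p (V p) (e i p) * lie_deriv_metric X g (e i) W p)"
    if "smooth V" "smooth W" for V W
  proof -
    have "V = (\<lambda>p. \<Sum>i\<in>I. g p (V p) (e i p) *\<^sub>R e i p)"
      using expansion by blast
    then have "lie_deriv_metric X g V W p =
        lie_deriv_metric X g (\<lambda>p. \<Sum>i\<in>I. g p (V p) (e i p) *\<^sub>R e i p) W p"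
      by simp
    also have "\<dots> = (\<Sum>i\<in>I. g p (V p) (e i p) * lie_deriv_metric X g (e i) W p)"
      by (simp add: lie_deriv_metric_sum_left lie_deriv_metric_scaleR_left that)
    finally show ?thesis .
  qed
  have "lie_deriv_metric X g (e i) Z p = 0" if "i \<in> I" for i
    using reduce[of Z "e i"] that by (simp add: lie_deriv_metric_commute[of X "e i" Z] frame)
  then show "lie_deriv_metric X g Y Z p = 0"
    by (simp add: reduce[of Y])
qed

end

section \<open>The Heisenberg group\<close>

definition heis_frame :: "real \<Rightarrow> nat \<Rightarrow> heis vfield" where
  "heis_frame l i = (\<lambda>p. if i = 1 then (l, 0, 0) else if i = 2 then (0, 1, - fst p) else (0, 0, 1))"

definition heis_structure :: "real \<Rightarrow> nat \<Rightarrow> nat \<Rightarrow> nat \<Rightarrow> real" where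
  "heis_structure l i j k =
    (if k = 3 then if i = 1 \<and> j = 2 then - l else if i = 2 \<and> j = 1 then l else 0 else 0)"

lemma heis_metric_eq:
  "heis_metric l p v w = fst v * fst w * inverse (l\<^sup>2) + fst (snd v) * fst (snd w)
      + (fst p * fst (snd v) + snd (snd v)) * (fst p * fst (snd w) + snd (snd w))"
  by (cases p; cases v; cases w) (simp add: divide_inverse)

lemma bilinear_heis_metric: "bilinear (heis_metric l p)"
  unfolding bilinear_def by (auto intro!: linearI simp: heis_metric_eq algebra_simps)

lemma smooth_heis_metric:
  "smooth Y \<Longrightarrow> smooth Z \<Longrightarrow> smooth (\<lambda>p. heis_metric l p (Y p) (Z p))"
  unfolding heis_metric_eq
  by (intro smooth_add smooth_mult smooth_fst smooth_snd smooth_const smooth_id)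

lemma heis_metric_eq_0D:
  assumes "0 < l" "heis_metric l p v v = 0"
  shows "v = 0"
proof -
  obtain x y z a b c where pv: "p = (x, y, z)" "v = (a, b, c)"
    by (metis prod_cases3)
  have "(a / l)\<^sup>2 + b\<^sup>2 + (x * b + c)\<^sup>2 = 0"
    using assms(2) by (simp add: pv power2_eq_square)
  then have "a / l = 0" "b = 0" "x * b + c = 0"
    by (smt (verit) zero_le_power2 zero_eq_power2)+
  with assms(1) show ?thesis
    by (simp add: pv zero_prod_def)
qed

lemma smooth_heis_frame: "smooth (heis_frame l i)"
  unfolding heis_frame_def
  by (cases "i = 1"; cases "i = 2")
    (auto intro!: smooth_const smooth_Pair smooth_minus smooth_fst smooth_id)

lemma dir_deriv_heis_frame:
  "dir_deriv X (heis_frame l i) p = (if i = 2 then (0, 0, - fst (X p)) else 0)"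
proof (cases "i = 2")
  case True
  have "((\<lambda>p::heis. (0::real, 1::real, - fst p)) has_derivative (\<lambda>v. (0, 0, - fst v))) (at p)"
    by (auto intro!: derivative_eq_intros)
  from dir_deriv_eqI[OF this, of X] True show ?thesis
    by (simp add: heis_frame_def)
qed (cases "i = 1"; simp add: heis_frame_def dir_deriv_const)

lemma lie_bracket_heis_frame:
  "lie_bracket (heis_frame l i) (heis_frame l j) p =
    (0, 0, if i = 1 \<and> j = 2 then - l else if i = 2 \<and> j = 1 then l else 0)"
  unfolding lie_bracket_def dir_deriv_heis_frame
  by (cases "i = 1"; cases "i = 2"; cases "j = 1"; cases "j = 2")
    (simp_all add: heis_frame_def zero_prod_def)

text \<open>The dual coframe is dx/l, dy, x dy + dz, whose squares add up to the metric; the only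
  nonzero brackets are those of the first two frame fields.\<close>

lemma heis_orthonormal_frame:
  assumes "0 < l" "levi_civita (heis_metric l) nabla"
  shows "orthonormal_frame (heis_metric l) nabla {1, 2, 3} (heis_frame l) (heis_structure l)"
proof unfold_locales
  show "levi_civita (heis_metric l) nabla" by fact
  show "smooth (\<lambda>p. heis_metric l p (Y p) (Z p))" if "smooth Y" "smooth Z" for Y Z
    using that by (rule smooth_heis_metric)
  show "bilinear (heis_metric l p)" for p
    by (rule bilinear_heis_metric)
  show "heis_metric l p v w = heis_metric l p w v" for p v w
    by (simp add: heis_metric_eq algebra_simps)
  show "v = 0" if "heis_metric l p v v = 0" for p v
    using assms(1) that by (rule heis_metric_eq_0D)
  show "smooth (heis_frame l i)" for i
    by (rule smooth_heis_frame)
  show "heis_metric l p (heis_frame l i p) (heis_frame l j p) = (if i = j then 1 else 0)"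
    if "i \<in> {1, 2, 3}" "j \<in> {1, 2, 3}" for i j p
    using that assms(1) by (auto simp: heis_metric_eq heis_frame_def power2_eq_square field_simps)
  show "v = (\<Sum>i\<in>{1, 2, 3}. heis_metric l p v (heis_frame l i p) *\<^sub>R heis_frame l i p)" for v p
    using assms(1)
    by (cases v) (simp add: heis_metric_eq heis_frame_def power2_eq_square field_simps)
  show "heis_metric l p (lie_bracket (heis_frame l i) (heis_frame l j) p) (heis_frame l k p)
      = heis_structure l i j k"
    if "i \<in> {1, 2, 3}" "j \<in> {1, 2, 3}" "k \<in> {1, 2, 3}" for i j k p
    using that(3) unfolding lie_bracket_heis_frame
    by (auto simp: heis_metric_eq heis_frame_def heis_structure_def)
qed

section \<open>Integrability conditions for an affine field\<close>

lemma heis_affine_imp_killing: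
  assumes "0 < l" "levi_civita (heis_metric l) nabla" "smooth X" "affine_field nabla X"
  shows "killing_field (heis_metric l) X"
proof -
  interpret orthonormal_frame "heis_metric l" nabla "{1, 2, 3::nat}" "heis_frame l" "heis_structure l"
    using assms(1,2) by (rule heis_orthonormal_frame)
  \<comment> \<open>The index 1 must stay a numeral, or it would be rewritten to
    \<open>Suc 0\<close> and no longer match the facts about \<open>a\<close>.\<close>
  note One_nat_def [simp del]
  let ?e = "heis_frame l"
  define a where "a = bracket_coeff X"
  have smooth_a: "smooth (a i j)" if "i \<in> {1, 2, 3}" "j \<in> {1, 2, 3}" for i j
    unfolding a_def using smooth_bracket_coeff[OF assms(3) that] .
  have D: "dir_deriv (?e i) (a j m) p = (\<Sum>k\<in>{1, 2, 3}. conn_coeff i j k * a k m p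
      + conn_coeff i m k * a j k p - a i k p * conn_coeff k j m)"
    if "i \<in> {1, 2, 3}" "j \<in> {1, 2, 3}" "m \<in> {1, 2, 3}" for i j m p
    unfolding a_def using affine_field_bracket_coeff[OF assms(4,3) that] .
  note D = D[simplified conn_coeff_def heis_structure_def, simplified]
  have commutator: "dir_deriv (?e 1) (dir_deriv (?e 2) f) p - dir_deriv (?e 2) (dir_deriv (?e 1) f) p
      = - l * dir_deriv (?e 3) f p" if "smooth f" for f :: "heis \<Rightarrow> real" and p
  proof -
    have "lie_bracket (?e 1) (?e 2) = (\<lambda>p. - l *\<^sub>R ?e 3 p)"
      unfolding fun_eq_iff lie_bracket_heis_frame by (simp add: heis_frame_def)
    with dir_deriv_lie_bracket[OF smooth_heis_frame smooth_heis_frame that, of l 1 l 2 p]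
    show ?thesis
      using fun_cong[OF dir_deriv_scaleR_field[OF that, of "\<lambda>_. - l" "?e 3"], of p] by simp
  qed
  have "dir_deriv (?e 1) (a 1 1) = (\<lambda>p. 0)"
    "dir_deriv (?e 2) (a 1 1) = (\<lambda>p. l / 2 * (a 1 3 p + a 3 1 p))"
    by (simp_all add: fun_eq_iff D field_simps)
  moreover have "dir_deriv (?e 1) (\<lambda>p. l / 2 * (a 1 3 p + a 3 1 p)) p
      = l / 2 * (l / 2 * (a 1 2 p + a 2 1 p))" for p
    using dir_deriv_cmult[OF smooth_add[OF smooth_a smooth_a], of 1 3 3 1 "?e 1" "l / 2"]
      dir_deriv_add[OF smooth_a smooth_a, of 1 3 3 1 "?e 1"]
    by (simp add: D field_simps)
  moreover have "dir_deriv (?e 3) (a 1 1) p = l / 2 * (a 1 2 p + a 2 1 p)" for p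
    by (simp add: D field_simps)
  \<comment> \<open>With s = a_12 + a_21 the commutator side is l^2/4 times s and the other side is
    -l^2/2 times s, which forces s = 0.\<close>
  ultimately have twice: "l / 2 * (l / 2 * (a 1 2 p + a 2 1 p)) - 0 = - l * (l / 2 * (a 1 2 p + a 2 1 p))" for p
    using commutator[OF smooth_a, of 1 1 p] by (simp only: dir_deriv_const) simp
  have "l * l * (a 1 2 p + a 2 1 p) = 0" for p
    using twice[of p] by (simp add: field_simps)
  then have s12: "a 1 2 p + a 2 1 p = 0" for p
    using assms(1) by simp
  \<comment> \<open>Differentiating a_12 + a_21 = 0 along e_1, e_2 and e_3 yields in turn
    \<open>s13\<close>, \<open>s23\<close> and \<open>d12\<close>, each up to a nonzero
    multiple.\<close>
  have D12: "dir_deriv (?e i) (a 1 2) p + dir_deriv (?e i) (a 2 1) p = 0" for i p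
    using fun_cong[OF dir_deriv_add[OF smooth_a smooth_a, of 1 2 2 1 "?e i"], of p]
    by (simp add: s12 dir_deriv_const)
  have cancel: "x = y" if "l * x = l * y" for x y
    using that assms(1) by simp
  have s13: "a 1 3 p + a 3 1 p = 0" for p
    by (rule cancel) (use D12[of 1 p] in \<open>simp add: D field_simps\<close>)
  have s23: "a 2 3 p + a 3 2 p = 0" for p
    by (rule cancel) (use D12[of 2 p] in \<open>simp add: D field_simps\<close>)
  have d12: "a 1 1 p = a 2 2 p" for p
    using D12[of 3 p] assms(1) by (auto simp: D field_simps)
  \<comment> \<open>The derivative along e_2 of the relation just found is l (a_33 - a_11).\<close>
  have "dir_deriv (?e 2) (a 1 3) p + dir_deriv (?e 2) (a 3 1) p = 0" for p
    using fun_cong[OF dir_deriv_add[OF smooth_a smooth_a, of 1 3 3 1 "?e 2"], of p]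
    by (simp add: s13 dir_deriv_const)
  then have d13: "a 1 1 p = a 3 3 p" for p
    using assms(1) d12[of p] by (simp add: D field_simps)
  have "dir_deriv (?e 1) (a 1 3) = (\<lambda>p. 0)"
    "dir_deriv (?e 2) (a 1 3) = (\<lambda>p. - l / 2 * a 1 1 p)"
    by (simp_all add: fun_eq_iff D d12[symmetric] d13[symmetric] field_simps)
  moreover have "dir_deriv (?e 1) (\<lambda>p. - l / 2 * a 1 1 p) p = 0" for p
    using dir_deriv_cmult[OF smooth_a, of 1 1 "?e 1" "- l / 2"] by (simp add: D)
  moreover have "dir_deriv (?e 3) (a 1 3) p = l * a 2 3 p" for p
    using add.inverse_unique[OF s23[of p], symmetric] by (simp add: D field_simps)
  \<comment> \<open>Both iterated derivatives of a_13 vanish, because e_1 kills a_13 and a_11. The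
    commutator relation therefore isolates a_23.\<close>
  ultimately have "0 - 0 = - l * (l * a 2 3 p)" for p
    using commutator[OF smooth_a, of 1 3 p] by (simp only: dir_deriv_const) simp
  then have "a 2 3 = (\<lambda>p. 0)"
    using assms(1) by (simp add: fun_eq_iff)
  then have D23: "dir_deriv (?e 1) (a 2 3) p = 0" for p
    by (simp add: dir_deriv_const)
  \<comment> \<open>With equal diagonal entries the system gives e_1(a_23) = (l/2) a_11.\<close>
  have a11: "a 1 1 p = 0" for p
    using D23[of p] assms(1) d12[of p] d13[of p] by (simp add: D field_simps)
  have "bracket_coeff X i j p + bracket_coeff X j i p = 0"
    if "i \<in> {1, 2, 3}" "j \<in> {1, 2, 3}" for i j p
    using that a11[of p] s12[of p] s13[of p] s23[of p] d12[of p] d13[of p]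
    by (auto simp: a_def add.commute)
  with assms(3) show ?thesis
    by (rule killing_fieldI)
qed

theorem theorem3p2:
  fixes l :: real
    and nabla :: "heis vfield \<Rightarrow> heis vfield \<Rightarrow> heis vfield"
    and X :: "heis vfield"
  assumes "0 < l"
    and "levi_civita (heis_metric l) nabla"
    and "smooth X"
  shows "affine_field nabla X \<longleftrightarrow> killing_field (heis_metric l) X"
proof -
  interpret orthonormal_frame "heis_metric l" nabla "{1, 2, 3}" "heis_frame l" "heis_structure l"
    using assms(1,2) by (rule heis_orthonormal_frame)
  show ?thesis
    using heis_affine_imp_killing[OF assms] killing_imp_affine[OF _ assms(3)] by blast
qed

end
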